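(* For any positive integer $d$ and any $\varepsilon>0$, there exists a positive integer $n=n^h(d,\varepsilon)$ such that the following holds. Let $\mathcal{F}_1,\ldots,\mathcal{F}_n$ be $n$ finite families of convex sets in $\mathbb{R}^d$ such that for every choice $K_1\in\mathcal{F}_1,\ldots,K_n\in\mathcal{F}_n$ we have $\operatorname{vol}\left(\bigcap_{i=1}^nK_i\right)\ge1$. Then there is an index $i\in\{1,\ldots,n\}$ such that $$\operatorname{vol}\left(\bigcap\mathcal{F}_i\right)\ge\frac{1}{1+\varepsilon}.$$
   Context: $\operatorname{vol}$ is $d$-dimensional volume (possibly $+\infty$), and $\bigcap\mathcal{F}_i$ denotes the intersection of all members of $\mathcal{F}_i$. *)

theory Defs
  imports "HOL-Analysis.Analysis"
begin

text \<open>
  The possibly infinite \<open>d\<close>-dimensional volume, where \<open>d = CARD('d)\<close>.  Lebesgue measure is used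
  rather than \<^const>\<open>lborel\<close> because a convex set need not be a Borel set (think of a disc together
  with a non-Borel part of its boundary circle), and \<^const>\<open>emeasure\<close> is \<open>0\<close> on non-measurable sets.
\<close>

abbreviation vol :: "(real ^ 'd) set \<Rightarrow> ennreal" where
  "vol A \<equiv> emeasure lebesgue A"

end

theory Submission
  imports Defs
begin

text \<open>
  Two facts about volumes of compact convex sets drive the proof.  Stability: if every member of a
  family misses only a small proportion of a convex body \<open>L\<close>, then by Helly's theorem there is a
  point \<open>c\<close> such that all members contain the homothetic copy of \<open>L\<close> with centre \<open>c\<close> and ratio
  \<open>1 - t\<close>, so the intersection of the family is almost as large as \<open>L\<close>.  A crude quantitative Helly
  theorem: among finitely many convex sets there are \<open>k\<close> (depending on \<open>d\<close> only) whose intersection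
  has volume at most \<open>C\<close> times that of the intersection of all of them.

  Take a rainbow choice whose intersection has minimal volume \<open>v\<close>, and keep only \<open>k\<close> of its sets, so
  that the volume is at most \<open>C v\<close>.  If the claim fails, stability lets one re-insert the remaining
  colours one at a time, each time with a member that shrinks the current volume by a factor
  \<open>q < 1\<close> depending only on \<open>d\<close> and \<open>\<epsilon>\<close>.  With sufficiently many colours the resulting rainbow
  intersection has volume less than \<open>v\<close>, a contradiction.
\<close>

section \<open>Families missing little of a convex body\<close>

text \<open>Passing to indices on which \<open>A\<close> is injective makes the cardinality of an
  index set equal that of its family of values. If there are at most \<open>DIM('a)\<close> distinct
  values, \<open>meet\<close> already covers all of them.\<close>

lemma Helly_finite_INT:
  fixes A :: "'i \<Rightarrow> 'a::euclidean_space set"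
  assumes "finite I" "\<And>i. i \<in> I \<Longrightarrow> convex (A i)"
    and meet: "\<And>J. J \<subseteq> I \<Longrightarrow> card J \<le> DIM('a) + 1 \<Longrightarrow> (\<Inter>i\<in>J. A i) \<noteq> {}"
  shows "(\<Inter>i\<in>I. A i) \<noteq> {}"
proof (cases "card (A ` I) \<ge> DIM('a) + 1")
  case True
  show ?thesis
  proof (rule Helly[OF True])
    show "\<forall>S\<in>A ` I. convex S"
      using assms(2) by blast
    fix \<T> assume "\<T> \<subseteq> A ` I" "card \<T> = DIM('a) + 1"
    then obtain J where "J \<subseteq> I" "inj_on A J" "\<T> = A ` J"
      by (metis subset_image_inj)
    then show "\<Inter>\<T> \<noteq> {}"
      using meet[of J] \<open>card \<T> = _\<close> by (simp add: card_image)
  qed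
next
  case False
  obtain J where "J \<subseteq> I" "inj_on A J" "A ` I = A ` J"
    by (metis subset_image_inj order_refl)
  then show ?thesis
    using meet[of J] False by (simp add: card_image)
qed

text \<open>Union bound: if the intersection were empty, the sets \<open>L - A i\<close> would cover
  \<open>L\<close>, but their measures add up to less than that of \<open>L\<close>.\<close>

lemma INT_nonempty_if_measure_Diff:
  assumes "finite I" "L \<in> fmeasurable M" "\<And>i. i \<in> I \<Longrightarrow> A i \<in> sets M"
    and "measure M L > 0"
    and "\<And>i. i \<in> I \<Longrightarrow> measure M (L - A i) < measure M L / c" and "real (card I) \<le> c"
  shows "L \<inter> (\<Inter>i\<in>I. A i) \<noteq> {}"
proof
  assume "L \<inter> (\<Inter>i\<in>I. A i) = {}"
  then have L: "L = (\<Union>i\<in>I. L - A i)" by blast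
  have "I \<noteq> {}" using L assms(4) by force
  then have "c > 0"
    using assms(1,6) by (smt (verit) card_gt_0_iff of_nat_0_less_iff)
  have "measure M L \<le> (\<Sum>i\<in>I. measure M (L - A i))"
    by (subst L, rule measure_UNION_le) (use assms in \<open>auto intro: fmeasurableD\<close>)
  also have "\<dots> < (\<Sum>i\<in>I. measure M L / c)"
    by (rule sum_strict_mono) (use assms \<open>I \<noteq> {}\<close> in auto)
  also have "\<dots> = card I * (measure M L / c)" by simp
  also have "\<dots> \<le> c * (measure M L / c)"
    by (rule mult_right_mono) (use assms \<open>c > 0\<close> in auto)
  finally show False using \<open>c > 0\<close> by simp
qed

text \<open>The union bound makes any \<open>DIM('a) + 1\<close> of the sets meet inside
  \<open>L\<close>, Helly's theorem extends this to finite subfamilies, and compactness of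
  \<open>L\<close> to all of \<open>I\<close>. An infinite \<open>I\<close> matters: the index set
  used later is a product with \<open>L\<close>.\<close>

lemma Helly_measure:
  fixes A :: "'i \<Rightarrow> 'a::euclidean_space set"
  assumes L: "compact L" "convex L" "measure lebesgue L > 0"
    and A: "\<And>i. i \<in> I \<Longrightarrow> closed (A i)" "\<And>i. i \<in> I \<Longrightarrow> convex (A i)"
    and small: "\<And>i. i \<in> I \<Longrightarrow> measure lebesgue (L - A i) < measure lebesgue L / (DIM('a) + 1)"
  shows "L \<inter> (\<Inter>i\<in>I. A i) \<noteq> {}"
proof (rule compact_imp_fip_image[OF L(1) A(1)])
  fix I' assume I': "finite I'" "I' \<subseteq> I"
  have few: "L \<inter> (\<Inter>i\<in>J. A i) \<noteq> {}" if "J \<subseteq> I'" "card J \<le> DIM('a) + 1" for J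
    by (rule INT_nonempty_if_measure_Diff[where M = lebesgue and c = "DIM('a) + 1"])
      (use that I' L A small in \<open>auto intro: finite_subset lmeasurable_compact borel_closed\<close>)
  have "(\<Inter>i\<in>I'. L \<inter> A i) \<noteq> {}"
  proof (rule Helly_finite_INT[OF I'(1)])
    show "convex (L \<inter> A i)" if "i \<in> I'" for i
      using that I' A L by (auto intro: convex_Int)
    show "(\<Inter>i\<in>J. L \<inter> A i) \<noteq> {}" if "J \<subseteq> I'" "card J \<le> DIM('a) + 1" for J
      using few[OF that] by blast
  qed
  then show "L \<inter> (\<Inter>i\<in>I'. A i) \<noteq> {}"
    using few[of "{}"] by (cases "I' = {}") auto
qed auto

lemma measure_homothety:
  fixes S :: "'a::euclidean_space set"
  shows "measure lebesgue ((\<lambda>x. c + m *\<^sub>R x) ` S) = \<bar>m\<bar> ^ DIM('a) * measure lebesgue S"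
  using measure_lebesgue_affine[of m c S] by (simp add: add.commute)

lemma compact_homothety: "compact S \<Longrightarrow> compact ((\<lambda>x. c + m *\<^sub>R x) ` S)"
  for S :: "'a::real_normed_vector set"
  by (intro compact_continuous_image continuous_intros)

lemma measure_Inter_ge_homothety:
  fixes L :: "'a::euclidean_space set"
  assumes L: "compact L" "convex L" "measure lebesgue L > 0"
    and G: "\<And>K. K \<in> \<G> \<Longrightarrow> closed K" "\<And>K. K \<in> \<G> \<Longrightarrow> convex K"
    and t: "0 < t" "t < 1"
    and small: "\<And>K. K \<in> \<G> \<Longrightarrow>
      measure lebesgue (L - K) < t ^ DIM('a) / (DIM('a) + 1) * measure lebesgue L"
  shows "measure lebesgue (L \<inter> \<Inter>\<G>) \<ge> (1 - t) ^ DIM('a) * measure lebesgue L"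
proof -
  \<comment> \<open>\<open>A (K, y)\<close> collects the centres \<open>z\<close> for which the copy of \<open>y\<close> lies in \<open>K\<close>; a common point of all
    these sets is the centre of the homothety.\<close>
  define A :: "'a set \<times> 'a \<Rightarrow> 'a set" where "A = (\<lambda>(K, y). {z. (1 - t) *\<^sub>R y + t *\<^sub>R z \<in> K})"
  have A_vimage: "A (K, y) = (\<lambda>z. (1 - t) *\<^sub>R y + t *\<^sub>R z) -` K" for K y
    by (auto simp: A_def)
  have clA: "closed (A (K, y))" if "K \<in> \<G>" for K y
    unfolding A_vimage using G(1)[OF that] by (intro continuous_closed_vimage continuous_intros)
  have "L \<inter> (\<Inter>p\<in>\<G> \<times> L. A p) \<noteq> {}"
  proof (rule Helly_measure[OF L])
    fix p assume "p \<in> \<G> \<times> L"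
    then obtain K y where p: "p = (K, y)" and "K \<in> \<G>" "y \<in> L" by blast
    show "closed (A p)" using clA \<open>K \<in> \<G>\<close> p by simp
    have mix: "(1 - t) *\<^sub>R y + t *\<^sub>R ((1 - u) *\<^sub>R a + u *\<^sub>R b)
        = (1 - u) *\<^sub>R ((1 - t) *\<^sub>R y + t *\<^sub>R a) + u *\<^sub>R ((1 - t) *\<^sub>R y + t *\<^sub>R b)"
      for a b u by (simp add: algebra_simps)
    show "convex (A p)"
      unfolding p A_def convex_alt using convexD_alt[OF G(2)[OF \<open>K \<in> \<G>\<close>]] by (simp add: mix)
    \<comment> \<open>The map taking \<open>z\<close> to \<open>(1 - t) y + t z\<close> contracts
      volumes by \<open>t ^ DIM('a)\<close> and sends bad centres into \<open>L - K\<close>. This is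
      the source of the power of \<open>t\<close> in \<open>small\<close>.\<close>
    have "t ^ DIM('a) * measure lebesgue (L - A p)
        = measure lebesgue ((\<lambda>z. (1 - t) *\<^sub>R y + t *\<^sub>R z) ` (L - A p))"
      using t by (simp add: measure_homothety)
    also have "\<dots> \<le> measure lebesgue (L - K)"
    proof (rule measure_mono_fmeasurable)
      show "(\<lambda>z. (1 - t) *\<^sub>R y + t *\<^sub>R z) ` (L - A p) \<subseteq> L - K"
        using convexD_alt[OF L(2) \<open>y \<in> L\<close>] t by (auto simp: p A_def)
      show "L - K \<in> lmeasurable"
        using L G(1)[OF \<open>K \<in> \<G>\<close>] by (intro fmeasurable_Diff lmeasurable_compact) auto
      \<comment> \<open>Written as a difference of two compact sets, the image is visibly
        measurable.\<close>
      have "(\<lambda>z. (1 - t) *\<^sub>R y + t *\<^sub>R z) ` (L - A p)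
          = (\<lambda>z. (1 - t) *\<^sub>R y + t *\<^sub>R z) ` L - (\<lambda>z. (1 - t) *\<^sub>R y + t *\<^sub>R z) ` L \<inter> K"
        by (auto simp: p A_def)
      also have "\<dots> \<in> sets lebesgue"
        using L G(1)[OF \<open>K \<in> \<G>\<close>]
        by (intro sets.Diff fmeasurableD lmeasurable_compact compact_homothety compact_Int_closed)
      finally show "(\<lambda>z. (1 - t) *\<^sub>R y + t *\<^sub>R z) ` (L - A p) \<in> sets lebesgue" .
    qed
    also have "\<dots> < t ^ DIM('a) * (measure lebesgue L / (DIM('a) + 1))"
      using small[OF \<open>K \<in> \<G>\<close>] by simp
    finally show "measure lebesgue (L - A p) < measure lebesgue L / (DIM('a) + 1)"
      using t by (subst (asm) mult_less_cancel_left_pos) auto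
  qed
  then obtain c where c: "c \<in> L" "\<And>K y. K \<in> \<G> \<Longrightarrow> y \<in> L \<Longrightarrow> t *\<^sub>R c + (1 - t) *\<^sub>R y \<in> K"
    by (auto simp: A_def add.commute)
  have "(1 - t) ^ DIM('a) * measure lebesgue L
      = measure lebesgue ((\<lambda>y. t *\<^sub>R c + (1 - t) *\<^sub>R y) ` L)"
    using t by (simp add: measure_homothety)
  also have "\<dots> \<le> measure lebesgue (L \<inter> \<Inter>\<G>)"
  proof (rule measure_mono_fmeasurable)
    show "(\<lambda>y. t *\<^sub>R c + (1 - t) *\<^sub>R y) ` L \<subseteq> L \<inter> \<Inter>\<G>"
      using c convexD[OF L(2) c(1)] t by auto
    show "(\<lambda>y. t *\<^sub>R c + (1 - t) *\<^sub>R y) ` L \<in> sets lebesgue"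
      using L by (intro fmeasurableD lmeasurable_compact compact_homothety)
    show "L \<inter> \<Inter>\<G> \<in> lmeasurable"
      using L G by (intro lmeasurable_compact compact_Int_closed closed_Inter) auto
  qed
  finally show ?thesis .
qed

section \<open>Quantitative Helly theorem with a constant factor\<close>

lemma compact_rows:
  fixes L :: "'a::euclidean_space set"
  assumes "compact L"
  shows "compact {A :: 'a ^ 'n. \<forall>i. A $ i \<in> L}"
proof -
  obtain B where B: "\<And>x. x \<in> L \<Longrightarrow> norm x \<le> B"
    using compact_imp_bounded[OF assms] by (auto simp: bounded_iff)
  have "norm A \<le> real CARD('n) * B" if "\<forall>i. A $ i \<in> L" for A :: "'a ^ 'n"
  proof -
    have "norm A \<le> (\<Sum>i\<in>UNIV. norm (A $ i))"
      by (simp add: norm_vec_def L2_set_le_sum)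
    also have "\<dots> \<le> (\<Sum>i\<in>(UNIV :: 'n set). B)"
      by (intro sum_mono B) (use that in auto)
    finally show ?thesis by simp
  qed
  then have "bounded {A :: 'a ^ 'n. \<forall>i. A $ i \<in> L}"
    by (auto simp: bounded_iff)
  with closed_vector_box[of "\<lambda>_. L"] compact_imp_closed[OF assms] show ?thesis
    by (simp add: compact_eq_bounded_closed)
qed

text \<open>The weight missing from 1 is placed on the origin: the normalised combination lies in
  \<open>L\<close>, and scaling by \<open>s \<le> 1\<close> moves it towards 0.\<close>

lemma convex_subsum:
  fixes a :: "'i \<Rightarrow> 'a::real_vector"
  assumes "convex L" "0 \<in> L" "finite I" "\<And>i. i \<in> I \<Longrightarrow> a i \<in> L"
    and "\<And>i. i \<in> I \<Longrightarrow> u i \<ge> 0" "sum u I \<le> 1"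
  shows "(\<Sum>i\<in>I. u i *\<^sub>R a i) \<in> L"
proof (cases "sum u I = 0")
  case True
  then have "\<forall>i\<in>I. u i = 0"
    using assms by (simp add: sum_nonneg_eq_0_iff)
  then show ?thesis using assms by simp
next
  case False
  define s where "s = sum u I"
  have s: "s > 0" "s \<le> 1"
    using False assms sum_nonneg[of I u] by (auto simp: s_def)
  have "(\<Sum>i\<in>I. (u i / s) *\<^sub>R a i) \<in> L"
    by (rule convex_sum) (use assms s in \<open>auto simp: s_def simp flip: sum_divide_distrib\<close>)
  from convexD_alt[OF assms(1,2) this, of s] s show ?thesis
    by (simp add: scaleR_sum_right)
qed

text \<open>Take a simplex in \<open>L\<close> with one vertex at 0 and maximal volume;
  \<open>g\<close> is the coordinate map of the basis formed by its other vertices. The body then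
  lies between this simplex and the parallelepiped of coordinates in [-1, 1].\<close>

lemma parallelepiped_sandwich:
  fixes L :: "(real ^ 'n) set"
  assumes L: "compact L" "convex L" and zero: "0 \<in> interior L"
  obtains g :: "real ^ 'n \<Rightarrow> real ^ 'n" where "linear g" "inj g"
    and "\<And>\<mu>. (\<And>i. \<mu> $ i \<ge> 0) \<Longrightarrow> (\<Sum>i\<in>UNIV. \<mu> $ i) \<le> 1 \<Longrightarrow> g \<mu> \<in> L"
    and "\<And>y. y \<in> L \<Longrightarrow> \<exists>\<mu>. y = g \<mu> \<and> (\<forall>i. \<bar>\<mu> $ i\<bar> \<le> 1)"
proof -
  define S where "S = {A :: real ^ 'n ^ 'n. \<forall>i. A $ i \<in> L}"
  obtain e where e: "e > 0" "cball 0 e \<subseteq> L"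
    using zero by (auto simp: mem_interior_cball)
  \<comment> \<open>A nondegenerate competitor, which forces the maximal determinant to be
    nonzero.\<close>
  define E where "E = (\<chi> i j. if i = j then e else 0 :: real ^ 'n ^ 'n)"
  have "E $ i = e *\<^sub>R axis i 1" for i
    by (simp add: E_def axis_def vec_eq_iff)
  then have "E \<in> S"
    using e by (auto simp: S_def)
  have "det E \<noteq> 0"
    by (subst det_diagonal) (use e in \<open>auto simp: E_def\<close>)
  have "continuous_on S (\<lambda>A. \<bar>det A\<bar>)"
    unfolding det_def by (intro continuous_intros)
  moreover have "compact S"
    unfolding S_def by (rule compact_rows[OF L(1)])
  \<comment> \<open>Maximality of \<open>\<bar>det A\<bar>\<close> and Cramer's rule bound the coordinates of points of \<open>L\<close> in the basis of rows.\<close>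
  ultimately obtain A where "A \<in> S" and max: "\<And>A'. A' \<in> S \<Longrightarrow> \<bar>det A'\<bar> \<le> \<bar>det A\<bar>"
    using continuous_attains_sup[of S "\<lambda>A. \<bar>det A\<bar>"] \<open>E \<in> S\<close> by blast
  have "det A \<noteq> 0"
    using max[OF \<open>E \<in> S\<close>] \<open>det E \<noteq> 0\<close> by auto
  define g where "g = (\<lambda>\<mu>. \<Sum>i\<in>UNIV. \<mu> $ i *\<^sub>R A $ i)"
  have g_alt: "g = (*v) (transpose A)"
    by (auto simp: g_def matrix_mult_sum column_transpose row_def vec_eq_iff scalar_mult_eq_scaleR)
  have inv: "invertible (transpose A)"
    using \<open>det A \<noteq> 0\<close> by (simp add: invertible_det_nz det_transpose)
  show ?thesis
  proof
    show "linear g" by (simp add: g_alt)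
    show "inj g" using inv by (simp add: g_alt inj_matrix_vector_mult)
    show "g \<mu> \<in> L" if "\<And>i. \<mu> $ i \<ge> 0" "(\<Sum>i\<in>UNIV. \<mu> $ i) \<le> 1" for \<mu>
      unfolding g_def
      by (rule convex_subsum) (use L zero interior_subset that \<open>A \<in> S\<close> in \<open>auto simp: S_def\<close>)
    fix y assume "y \<in> L"
    have "surj g" using inv by (metis g_alt invertible_def matrix_right_invertible_surjective)
    then obtain \<mu> where \<mu>: "y = g \<mu>" by (meson surjD)
    have "\<bar>\<mu> $ k\<bar> \<le> 1" for k
    proof -
      have "\<bar>\<mu> $ k * det A\<bar> = \<bar>det (\<chi> i. if i = k then y else A $ i)\<bar>"
        using cramer_lemma_transpose[of k \<mu> A]
        by (simp add: \<mu> g_def row_def scalar_mult_eq_scaleR vec_lambda_eta cong: if_cong)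
      also have "\<dots> \<le> \<bar>det A\<bar>"
        by (rule max) (use \<open>y \<in> L\<close> \<open>A \<in> S\<close> in \<open>auto simp: S_def\<close>)
      finally show ?thesis
        using \<open>det A \<noteq> 0\<close> by (simp add: abs_mult)
    qed
    with \<mu> show "\<exists>\<mu>. y = g \<mu> \<and> (\<forall>i. \<bar>\<mu> $ i\<bar> \<le> 1)" by blast
  qed
qed

text \<open>A weak form of John's theorem: in the coordinates of \<open>g\<close>, a ball fits into
  the standard simplex, and a concentric ball larger by a factor \<open>4 d^2\<close> contains the
  cube of coordinates in [-1, 1].\<close>

lemma normal_position:
  fixes L :: "(real ^ 'n) set"
  assumes L: "compact L" "convex L" "interior L \<noteq> {}"
  obtains x :: "real ^ 'n" and f :: "real ^ 'n \<Rightarrow> real ^ 'n" where "linear f" "inj f"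
    and "(\<lambda>v. x + f v) ` cball 0 1 \<subseteq> L"
    and "L \<subseteq> (\<lambda>v. x + f v) ` cball 0 (4 * real CARD('n) ^ 2)"
proof -
  define d where "d = real CARD('n)"
  have d: "d \<ge> 1" by (simp add: d_def Suc_leI)
  obtain p where "p \<in> interior L" using L by blast
  define L' where "L' = (+) (- p) ` L"
  have "0 \<in> interior L'"
    unfolding L'_def interior_translation using \<open>p \<in> interior L\<close>
    by (intro image_eqI[of _ _ p]) auto
  moreover have "compact L'" "convex L'"
    unfolding L'_def using L compact_translation convex_translation by blast+
  ultimately obtain g :: "real ^ 'n \<Rightarrow> real ^ 'n" where g: "linear g" "inj g"
    and in_L: "\<And>\<mu>. (\<And>i. \<mu> $ i \<ge> 0) \<Longrightarrow> (\<Sum>i\<in>UNIV. \<mu> $ i) \<le> 1 \<Longrightarrow> g \<mu> \<in> L'"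
    and coords: "\<And>y. y \<in> L' \<Longrightarrow> \<exists>\<mu>. y = g \<mu> \<and> (\<forall>i. \<bar>\<mu> $ i\<bar> \<le> 1)"
    using parallelepiped_sandwich by blast
  interpret g: linear g by fact
  \<comment> \<open>The ball of radius \<open>1 / (2 d)\<close> about \<open>b\<close> has
    coordinates in [0, 1/d], so it stays in the simplex. Points of the cube are within
    \<open>2 d\<close> of \<open>b\<close>; dividing by the inner radius gives
    \<open>4 d^2\<close>.\<close>
  define b :: "real ^ 'n" where "b = (\<chi> i. 1 / (2 * d))"
  define f where "f v = g ((1 / (2 * d)) *\<^sub>R v)" for v
  show ?thesis
  proof
    show "linear f"
      unfolding f_def by (intro linear_compose[unfolded o_def, OF _ g(1)] linear_scaleR)
    show "inj f"
      using d by (auto simp: f_def intro!: injI dest!: injD[OF g(2)])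
    show "(\<lambda>v. (p + g b) + f v) ` cball 0 1 \<subseteq> L"
    proof clarsimp
      fix v :: "real ^ 'n" assume v: "norm v \<le> 1"
      define \<mu> where "\<mu> = b + (1 / (2 * d)) *\<^sub>R v"
      have vi: "\<bar>v $ i\<bar> \<le> 1" for i
        using component_le_norm_cart[of v i] v by linarith
      have \<mu>: "\<mu> $ i = (1 + v $ i) / (2 * d)" for i
        by (simp add: \<mu>_def b_def add_divide_distrib)
      have "g \<mu> \<in> L'"
      proof (rule in_L)
        show "\<mu> $ i \<ge> 0" for i
          using vi[of i] d by (simp add: \<mu>)
        have "(\<Sum>i\<in>UNIV. \<mu> $ i) \<le> (\<Sum>i\<in>(UNIV :: 'n set). 1 / d)"
          by (rule sum_mono) (use vi d in \<open>auto simp: \<mu> field_simps abs_le_iff\<close>)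
        then show "(\<Sum>i\<in>UNIV. \<mu> $ i) \<le> 1"
          using d by (simp add: d_def)
      qed
      then show "p + g b + f v \<in> L"
        by (auto simp: \<mu>_def f_def L'_def g.add algebra_simps)
    qed
    show "L \<subseteq> (\<lambda>v. (p + g b) + f v) ` cball 0 (4 * real CARD('n) ^ 2)"
    proof
      fix y assume "y \<in> L"
      then have "y - p \<in> L'" by (auto simp: L'_def image_iff)
      then obtain \<mu> where \<mu>: "y - p = g \<mu>" "\<And>i. \<bar>\<mu> $ i\<bar> \<le> 1"
        using coords by blast
      have "norm (\<mu> - b) \<le> (\<Sum>i\<in>UNIV. \<bar>(\<mu> - b) $ i\<bar>)"
        by (rule norm_le_l1_cart)
      also have "\<dots> \<le> (\<Sum>i\<in>(UNIV :: 'n set). 2)"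
      proof (rule sum_mono)
        fix i
        have "0 \<le> b $ i" "b $ i \<le> 1" using d by (auto simp: b_def field_simps)
        then show "\<bar>(\<mu> - b) $ i\<bar> \<le> 2" using \<mu>(2)[of i] by simp
      qed
      finally have "norm (\<mu> - b) \<le> 2 * d" by (simp add: d_def)
      then have "norm ((2 * d) *\<^sub>R (\<mu> - b)) \<le> 4 * d ^ 2"
        using d by (simp add: power2_eq_square)
      moreover have "y = p + g b + f ((2 * d) *\<^sub>R (\<mu> - b))"
        using \<mu>(1) d by (simp add: f_def g.diff algebra_simps)
      ultimately show "y \<in> (\<lambda>v. (p + g b) + f v) ` cball 0 (4 * real CARD('n) ^ 2)"
        by (auto simp: d_def)
    qed
  qed
qed

text \<open>
  Each point of the net \<open>Y\<close> of the sphere is excluded by one of the sets.  A point of their intersection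
  far outside would, together with the inner ellipsoid, span a cone that contains a net point.
\<close>

lemma few_sets_subset_ellipsoid:
  fixes f :: "'a::euclidean_space \<Rightarrow> 'a" and Y :: "'a set"
  assumes Y: "finite Y" "Y \<subseteq> sphere 0 (2 * R)" "sphere 0 (2 * R) \<subseteq> (\<Union>y\<in>Y. ball y (1 / 2))"
    and R: "R \<ge> 1"
    and K: "\<And>i. i \<in> I \<Longrightarrow> convex (K i)"
    and f: "linear f" "inj f"
    and inner: "(\<lambda>v. x + f v) ` cball 0 1 \<subseteq> (\<Inter>i\<in>I. K i)"
    and outer: "(\<Inter>i\<in>I. K i) \<subseteq> (\<lambda>v. x + f v) ` cball 0 R"
  shows "\<exists>T\<subseteq>I. finite T \<and> card T \<le> card Y \<and> (\<Inter>i\<in>T. K i) \<subseteq> (\<lambda>v. x + f v) ` cball 0 (4 * R)"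
proof -
  interpret f: linear f by fact
  \<comment> \<open>A net point has norm \<open>2 R\<close>, while \<open>outer\<close> confines the
    whole intersection to norm at most \<open>R\<close>.\<close>
  have "\<exists>i\<in>I. x + f y \<notin> K i" if "y \<in> Y" for y
  proof (rule ccontr)
    assume "\<not> ?thesis"
    then obtain v where "x + f y = x + f v" "norm v \<le> R"
      using outer by force
    moreover have "norm y = 2 * R" using that Y(2) by auto
    moreover have "y = v" using injD[OF f(2), of y v] calculation by simp
    ultimately show False using R by simp
  qed
  then obtain \<iota> where \<iota>: "\<And>y. y \<in> Y \<Longrightarrow> \<iota> y \<in> I" "\<And>y. y \<in> Y \<Longrightarrow> x + f y \<notin> K (\<iota> y)"
    by metis
  have "z \<in> (\<lambda>v. x + f v) ` cball 0 (4 * R)" if z: "z \<in> (\<Inter>i\<in>\<iota> ` Y. K i)" for z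
  proof -
    have "surj f" using f linear_injective_imp_surjective by blast
    then obtain v where v: "z - x = f v" by (meson surjD)
    have "norm v \<le> 4 * R"
    proof (rule ccontr)
      assume "\<not> ?thesis"
      then have large: "norm v > 4 * R" and "norm v > 0" using R by linarith+
      \<comment> \<open>Rescales \<open>v\<close> to the sphere carrying the net. The bound
        \<open>4 R\<close> makes \<open>s < 1 / 2\<close>, so more than half of the weight is left
        for a point of the inner ball.\<close>
      define s where "s = 2 * R / norm v"
      have s: "0 < s" "s < 1 / 2"
        using large \<open>norm v > 0\<close> R by (simp_all add: s_def divide_less_eq)
      have "norm (s *\<^sub>R v) = 2 * R"
        using \<open>norm v > 0\<close> R by (simp add: s_def)
      then have "s *\<^sub>R v \<in> sphere 0 (2 * R)" by simp
      from subsetD[OF Y(3) this] obtain y where y: "y \<in> Y" "dist y (s *\<^sub>R v) < 1 / 2"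
        by auto
      \<comment> \<open>Solves \<open>y = (1 - s) w + s v\<close>. As \<open>y\<close> is within
        \<open>1 / 2 < 1 - s\<close> of \<open>s v\<close>, the solution lies in the unit
        ball.\<close>
      define w where "w = (1 / (1 - s)) *\<^sub>R (y - s *\<^sub>R v)"
      have y_eq: "y = (1 - s) *\<^sub>R w + s *\<^sub>R v"
        using \<open>s < 1 / 2\<close> by (simp only: w_def scaleR_scaleR) simp
      have "norm w = dist y (s *\<^sub>R v) / (1 - s)"
        using \<open>s < 1 / 2\<close> by (simp only: w_def norm_scaleR dist_norm) simp
      also have "\<dots> \<le> 1"
        using y(2) \<open>s < 1 / 2\<close> by (simp add: pos_divide_le_eq)
      finally have "norm w \<le> 1" .
      then have "x + f w \<in> (\<Inter>i\<in>I. K i)"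
        by (intro subsetD[OF inner] image_eqI[of _ _ w]) simp_all
      then have "x + f w \<in> K (\<iota> y)"
        using \<iota>(1)[OF y(1)] by blast
      moreover have "x + f v \<in> K (\<iota> y)"
        using z y(1) by (simp flip: v)
      ultimately have "(1 - s) *\<^sub>R (x + f w) + s *\<^sub>R (x + f v) \<in> K (\<iota> y)"
        using s by (intro convexD_alt[OF K[OF \<iota>(1)[OF y(1)]]]) simp_all
      moreover have "(1 - s) *\<^sub>R (x + f w) + s *\<^sub>R (x + f v) = x + f y"
        by (simp add: y_eq f.add f.diff f.scale algebra_simps)
      ultimately show False using \<iota>(2)[OF y(1)] by simp
    qed
    moreover have "z = x + f v" using v by (simp flip: v)
    ultimately show ?thesis by (intro image_eqI[of _ _ v]) simp_all
  qed
  moreover have "\<iota> ` Y \<subseteq> I" "finite (\<iota> ` Y)" "card (\<iota> ` Y) \<le> card Y"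
    using \<iota>(1) Y(1) card_image_le by auto
  ultimately show ?thesis by blast
qed

text \<open>The number \<open>k\<close> is the size of a net of a sphere whose radius depends on the
  dimension only, so it precedes the family in the quantifiers. With \<open>R = 4 d^2\<close>, the
  selected sets lie in the inner ellipsoid enlarged by \<open>4 R = 16 d^2\<close>, whence the
  factor.\<close>

lemma quantitative_Helly_constant:
  "\<exists>k. \<forall>(I :: 'i set) (K :: 'i \<Rightarrow> (real ^ 'n) set). finite I \<longrightarrow> I \<noteq> {} \<longrightarrow>
    (\<forall>i\<in>I. compact (K i) \<and> convex (K i)) \<longrightarrow> measure lebesgue (\<Inter>i\<in>I. K i) > 0 \<longrightarrow>
    (\<exists>T\<subseteq>I. T \<noteq> {} \<and> card T \<le> k \<and> measure lebesgue (\<Inter>i\<in>T. K i)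
      \<le> (16 * real CARD('n) ^ 2) ^ CARD('n) * measure lebesgue (\<Inter>i\<in>I. K i))"
proof -
  define R where "R = 4 * real CARD('n) ^ 2"
  have "real CARD('n) \<ge> 1" by (simp add: Suc_leI)
  then have R: "R \<ge> 1"
    unfolding R_def using one_le_power[of "real CARD('n)" 2] by linarith
  obtain Y where Y: "finite Y" "Y \<subseteq> sphere (0 :: real ^ 'n) (2 * R)"
      "sphere 0 (2 * R) \<subseteq> (\<Union>y\<in>Y. ball y (1 / 2))"
    using seq_compact_imp_totally_bounded[of "sphere (0 :: real ^ 'n) (2 * R)"]
    by (metis compact_imp_seq_compact compact_sphere half_gt_zero zero_less_one)
  show ?thesis
  proof (intro exI[of _ "card Y"] allI impI)
    fix I :: "'i set" and K :: "'i \<Rightarrow> (real ^ 'n) set"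
    assume I: "finite I" "I \<noteq> {}" and K: "\<forall>i\<in>I. compact (K i) \<and> convex (K i)"
      and pos: "measure lebesgue (\<Inter>i\<in>I. K i) > 0"
    define L where "L = (\<Inter>i\<in>I. K i)"
    have L: "compact L" "convex L"
      unfolding L_def using I K by (auto intro!: compact_Inter convex_INT)
    have "\<not> negligible L"
      using pos by (auto simp: L_def negligible_iff_measure)
    then have "interior L \<noteq> {}"
      using negligible_convex_interior[OF L(2)] by simp
    with L obtain x and f :: "real ^ 'n \<Rightarrow> real ^ 'n" where f: "linear f" "inj f"
      and inner: "(\<lambda>v. x + f v) ` cball 0 1 \<subseteq> L"
      and outer: "L \<subseteq> (\<lambda>v. x + f v) ` cball 0 R"
      unfolding R_def by (rule normal_position)
    obtain T where T: "T \<subseteq> I" "card T \<le> card Y"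
      and sub: "(\<Inter>i\<in>T. K i) \<subseteq> (\<lambda>v. x + f v) ` cball 0 (4 * R)"
      using few_sets_subset_ellipsoid[OF Y R _ f, of I K x] inner outer K unfolding L_def by blast
    interpret f: linear f by fact
    have compact_ellipsoid: "compact ((\<lambda>v. x + f v) ` cball 0 r)" for r
      using f(1) linear_continuous_on[of f]
      by (intro compact_continuous_image continuous_intros) (auto simp: linear_conv_bounded_linear)
    then have ellipsoid: "(\<lambda>v. x + f v) ` cball 0 r \<in> lmeasurable" for r
      by (rule lmeasurable_compact)
    \<comment> \<open>An empty \<open>T\<close> would have the whole space as intersection, which no
      ellipsoid contains.\<close>
    have "T \<noteq> {}"
      using sub compact_ellipsoid[of "4 * R"] not_compact_UNIV[where 'a = "real ^ 'n"]
      by (metis INT_empty top.extremum_uniqueI)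
    have "(\<lambda>v. x + f v) ` cball 0 (4 * R)
        = (\<lambda>z. (1 - 4 * R) *\<^sub>R x + (4 * R) *\<^sub>R z) ` (\<lambda>v. x + f v) ` cball 0 1"
    proof -
      have "cball 0 (4 * R) = (*\<^sub>R) (4 * R) ` cball (0 :: real ^ 'n) 1"
        using R by (simp add: cball_scale)
      then show ?thesis
        by (simp add: image_image f.scale algebra_simps)
    qed
    then have "measure lebesgue ((\<lambda>v. x + f v) ` cball 0 (4 * R))
        = (4 * R) ^ CARD('n) * measure lebesgue ((\<lambda>v. x + f v) ` cball 0 1)"
      using R by (simp add: measure_homothety)
    also have "\<dots> \<le> (4 * R) ^ CARD('n) * measure lebesgue L"
      by (intro mult_left_mono measure_mono_fmeasurable inner fmeasurableD ellipsoid
          lmeasurable_compact L) (use R in simp)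
    finally have "measure lebesgue ((\<lambda>v. x + f v) ` cball 0 (4 * R)) \<le> \<dots>" .
    moreover have "compact (\<Inter>i\<in>T. K i)"
      using \<open>T \<noteq> {}\<close> T K by (intro compact_Inter) auto
    then have "measure lebesgue (\<Inter>i\<in>T. K i) \<le> measure lebesgue ((\<lambda>v. x + f v) ` cball 0 (4 * R))"
      by (intro measure_mono_fmeasurable sub fmeasurableD ellipsoid lmeasurable_compact)
    ultimately show "\<exists>T\<subseteq>I. T \<noteq> {} \<and> card T \<le> card Y \<and> measure lebesgue (\<Inter>i\<in>T. K i)
      \<le> (16 * real CARD('n) ^ 2) ^ CARD('n) * measure lebesgue (\<Inter>i\<in>I. K i)"
      using T \<open>T \<noteq> {}\<close> by (intro exI[of _ T]) (auto simp: R_def L_def)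
  qed
qed

section \<open>Rainbow selections\<close>

text \<open>Contrapositive of stability: if every member kept more than this proportion of
  \<open>L\<close>, the intersection of the family would be too large.\<close>

lemma exists_shrinking_member:
  fixes L :: "'a::euclidean_space set"
  assumes L: "compact L" "convex L" "measure lebesgue L > 0"
    and G: "\<G> \<noteq> {}" "\<And>K. K \<in> \<G> \<Longrightarrow> compact K" "\<And>K. K \<in> \<G> \<Longrightarrow> convex K"
    and t: "0 < t" "t < 1"
    and small: "measure lebesgue (\<Inter>\<G>) < (1 - t) ^ DIM('a) * measure lebesgue L"
  shows "\<exists>K\<in>\<G>. measure lebesgue (L \<inter> K) \<le> (1 - t ^ DIM('a) / (DIM('a) + 1)) * measure lebesgue L"
proof (rule ccontr)
  assume no: "\<not> ?thesis"
  have "measure lebesgue (L - K) < t ^ DIM('a) / (DIM('a) + 1) * measure lebesgue L"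
    if "K \<in> \<G>" for K
  proof -
    have "L \<in> lmeasurable" "L \<inter> K \<in> lmeasurable"
      using L G(2)[OF that] by (auto intro!: lmeasurable_compact compact_Int)
    then have "measure lebesgue (L - L \<inter> K) = measure lebesgue L - measure lebesgue (L \<inter> K)"
      by (intro measurable_measure_Diff fmeasurableD) auto
    moreover have "L - L \<inter> K = L - K" by blast
    moreover have "(1 - t ^ DIM('a) / (DIM('a) + 1)) * measure lebesgue L < measure lebesgue (L \<inter> K)"
      using no that by force
    ultimately show ?thesis by (simp add: left_diff_distrib)
  qed
  then have "(1 - t) ^ DIM('a) * measure lebesgue L \<le> measure lebesgue (L \<inter> \<Inter>\<G>)"
    using G by (intro measure_Inter_ge_homothety L t) (auto intro: compact_imp_closed)
  also have "\<dots> \<le> measure lebesgue (\<Inter>\<G>)"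
  proof (rule measure_mono_fmeasurable)
    show "L \<inter> \<Inter>\<G> \<in> sets lebesgue" "\<Inter>\<G> \<in> lmeasurable"
      using L G by (auto intro!: fmeasurableD[OF lmeasurable_compact] lmeasurable_compact
          compact_Int compact_Inter)
  qed auto
  finally show False using small by simp
qed

text \<open>The factor \<open>C\<close> lost on passing to the few sets of \<open>few\<close> is
  regained by \<open>m\<close> shrinkings, according to \<open>m\<close>. The hypothesis on
  \<open>card I\<close> leaves at least \<open>m\<close> colours to re-insert.\<close>

lemma colourful_Helly_measure_compact:
  fixes F :: "'i \<Rightarrow> (real ^ 'n) set set"
  assumes I: "finite I" "I \<noteq> {}" "k + m \<le> card I"
    and F: "\<And>i. i \<in> I \<Longrightarrow> finite (F i)" "\<And>i. i \<in> I \<Longrightarrow> F i \<noteq> {}"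
      "\<And>i K. i \<in> I \<Longrightarrow> K \<in> F i \<Longrightarrow> compact K" "\<And>i K. i \<in> I \<Longrightarrow> K \<in> F i \<Longrightarrow> convex K"
    and few: "\<And>K :: 'i \<Rightarrow> (real ^ 'n) set. (\<forall>i\<in>I. compact (K i) \<and> convex (K i)) \<Longrightarrow>
      measure lebesgue (\<Inter>i\<in>I. K i) > 0 \<Longrightarrow>
      \<exists>T\<subseteq>I. T \<noteq> {} \<and> card T \<le> k \<and>
        measure lebesgue (\<Inter>i\<in>T. K i) \<le> C * measure lebesgue (\<Inter>i\<in>I. K i)"
    and t: "0 < t" "t < 1"
    and m: "(1 - t ^ CARD('n) / (CARD('n) + 1)) ^ m * C < 1"
    and a: "a > 0" and rainbow: "\<And>K. (\<And>i. i \<in> I \<Longrightarrow> K i \<in> F i) \<Longrightarrow> measure lebesgue (\<Inter>i\<in>I. K i) \<ge> a"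
  shows "\<exists>i\<in>I. measure lebesgue (\<Inter>(F i)) \<ge> (1 - t) ^ CARD('n) * a"
proof (rule ccontr)
  assume "\<not> ?thesis"
  then have less: "\<And>i. i \<in> I \<Longrightarrow> measure lebesgue (\<Inter>(F i)) < (1 - t) ^ CARD('n) * a"
    by force
  define q where "q = 1 - t ^ CARD('n) / (CARD('n) + 1)"
  have "t ^ CARD('n) \<le> 1" "t ^ CARD('n) > 0"
    using t by (auto simp: power_le_one)
  then have q: "0 \<le> q" "q \<le> 1"
    by (simp_all add: q_def divide_le_eq)
  define V where "V T K = measure lebesgue (\<Inter>i\<in>T. K i)" for T and K :: "'i \<Rightarrow> (real ^ 'n) set"
  \<comment> \<open>Values outside \<open>I\<close> are left free, so that updates at a colour stay
    in \<open>sel\<close>; \<open>PiE I F\<close> is its finite counterpart, where a minimum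
    exists.\<close>
  define sel where "sel = {K. \<forall>i\<in>I. K i \<in> F i}"
  have compact_INT: "compact (\<Inter>i\<in>T. K i)" if "K \<in> sel" "T \<subseteq> I" "T \<noteq> {}" for K T
    using that F(3) by (intro compact_Inter) (auto simp: sel_def)
  have V_ge: "a \<le> V T K" if "K \<in> sel" "T \<subseteq> I" "T \<noteq> {}" for K T
  proof -
    have "a \<le> V I K" using rainbow[of K] that by (auto simp: V_def sel_def)
    also have "\<dots> \<le> V T K"
      unfolding V_def using that I
      by (intro measure_mono_fmeasurable INF_superset_mono order_refl fmeasurableD
          lmeasurable_compact compact_INT) auto
    finally show ?thesis .
  qed
  have "finite (PiE I F)" "PiE I F \<noteq> {}"
    using I F by (auto intro: finite_PiE simp: PiE_eq_empty_iff)
  then obtain K0 where K0: "K0 \<in> PiE I F" and min: "\<And>K. K \<in> PiE I F \<Longrightarrow> V I K0 \<le> V I K"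
    using ex_min_if_finite[of "V I ` PiE I F"] by (metis (no_types, lifting) finite_imageI
      image_iff image_is_empty linorder_not_less imageI)
  have "K0 \<in> sel" using K0 by (auto simp: sel_def)
  have min_sel: "V I K0 \<le> V I K" if "K \<in> sel" for K
    using min[of "restrict K I"] that by (auto simp: sel_def V_def)
  have "V I K0 > 0"
    using V_ge[OF \<open>K0 \<in> sel\<close> order_refl I(2)] a by simp
  moreover have "\<forall>i\<in>I. compact (K0 i) \<and> convex (K0 i)"
    using \<open>K0 \<in> sel\<close> F by (auto simp: sel_def)
  ultimately obtain T where T: "T \<subseteq> I" "T \<noteq> {}" "card T \<le> k" "V T K0 \<le> C * V I K0"
    using few[of K0] by (auto simp: V_def)
  \<comment> \<open>The sets of \<open>K0\<close> on \<open>T\<close> cost \<open>V T K0\<close>;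
    each colour added from outside \<open>T\<close> contributes one factor \<open>q\<close>.\<close>
  have grow: "\<exists>K\<in>sel. V (T \<union> S) K \<le> q ^ card S * V T K0" if "finite S" "S \<subseteq> I - T" for S
    using that
  proof (induction S rule: finite_induct)
    case empty
    then show ?case using \<open>K0 \<in> sel\<close> by auto
  next
    case (insert j S)
    then obtain K where K: "K \<in> sel" "V (T \<union> S) K \<le> q ^ card S * V T K0" by auto
    define L where "L = (\<Inter>i\<in>T \<union> S. K i)"
    have TS: "T \<union> S \<subseteq> I" "T \<union> S \<noteq> {}" "j \<in> I" "j \<notin> T \<union> S"
      using T insert by auto
    have "compact L" unfolding L_def by (rule compact_INT[OF K(1) TS(1,2)])
    have "convex L"
      using K(1) TS F(4) by (auto simp: L_def sel_def intro!: convex_INT)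
    have "a \<le> measure lebesgue L"
      using V_ge[OF K(1) TS(1,2)] by (simp add: L_def V_def)
    \<comment> \<open>The failing bound is stated relative to \<open>a\<close>. Every partial
      intersection has measure at least \<open>a\<close>, so the bound also fails relative to the
      current \<open>L\<close>.\<close>
    then have "(1 - t) ^ CARD('n) * a \<le> (1 - t) ^ CARD('n) * measure lebesgue L"
      using t by (intro mult_left_mono) auto
    with less[OF \<open>j \<in> I\<close>] have "measure lebesgue (\<Inter>(F j)) < (1 - t) ^ CARD('n) * measure lebesgue L"
      by (rule less_le_trans)
    then have "\<exists>X\<in>F j. measure lebesgue (L \<inter> X) \<le> q * measure lebesgue L"
      using exists_shrinking_member[of L "F j" t] \<open>compact L\<close> \<open>convex L\<close> \<open>a \<le> measure lebesgue L\<close>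
        a t F(2-4)[OF \<open>j \<in> I\<close>] by (simp add: q_def)
    then obtain X where X: "X \<in> F j" "measure lebesgue (L \<inter> X) \<le> q * measure lebesgue L"
      by blast
    have "K(j := X) \<in> sel"
      using K(1) X(1) by (auto simp: sel_def)
    moreover have "(\<Inter>i\<in>T \<union> insert j S. (K(j := X)) i) = L \<inter> X"
      using TS(4) by (auto simp: L_def)
    then have "V (T \<union> insert j S) (K(j := X)) \<le> q * V (T \<union> S) K"
      using X(2) unfolding V_def L_def by simp
    moreover have "q * V (T \<union> S) K \<le> q * (q ^ card S * V T K0)"
      by (rule mult_left_mono[OF K(2) q(1)])
    moreover have "q * (q ^ card S * V T K0) = q ^ card (insert j S) * V T K0"
      using insert by simp
    ultimately show ?case
      by (intro bexI[of _ "K(j := X)"]) linarith+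
  qed
  obtain K where K: "K \<in> sel" "V (T \<union> (I - T)) K \<le> q ^ card (I - T) * V T K0"
    using grow[of "I - T"] I by auto
  have "m \<le> card (I - T)"
    using T I by (simp add: card_Diff_subset finite_subset)
  have "V I K \<le> q ^ card (I - T) * V T K0"
    using K(2) T(1) by (simp add: Un_absorb1)
  also have "\<dots> \<le> q ^ m * (C * V I K0)"
    using q \<open>m \<le> card (I - T)\<close> T(4)
    by (intro mult_mono power_decreasing) (auto simp: V_def)
  also have "\<dots> < V I K0"
    using m \<open>V I K0 > 0\<close> by (simp add: q_def mult.assoc[symmetric])
  finally show False using min_sel[OF K(1)] by simp
qed

section \<open>From compact to arbitrary convex sets\<close>

lemma convex_lebesgue_measurable:
  fixes K :: "'a::euclidean_space set"
  assumes "convex K"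
  shows "K \<in> sets lebesgue"
proof -
  have "K \<inter> cball 0 (real r) \<in> sets lebesgue" for r
    using assms by (intro fmeasurableD measurable_convex convex_Int bounded_Int) auto
  then have "(\<Union>r. K \<inter> cball 0 (real r)) \<in> sets lebesgue" by blast
  also have "(\<Union>r. K \<inter> cball 0 (real r)) = K"
    using real_arch_simple by fastforce
  finally show ?thesis .
qed

lemma emeasure_Int_cball_tendsto:
  fixes K :: "'a::euclidean_space set"
  assumes "K \<in> sets lebesgue"
  shows "(\<lambda>r. emeasure lebesgue (K \<inter> cball 0 (real r))) \<longlonglongrightarrow> emeasure lebesgue K"
proof -
  have "(\<Union>r. K \<inter> cball 0 (real r)) = K"
    using real_arch_simple by fastforce
  moreover have "incseq (\<lambda>r. K \<inter> cball 0 (real r))"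
    by (auto simp: incseq_def)
  moreover have "range (\<lambda>r. K \<inter> cball 0 (real r)) \<subseteq> sets lebesgue"
    using assms by auto
  ultimately show ?thesis
    using Lim_emeasure_incseq[of "\<lambda>r. K \<inter> cball 0 (real r)" lebesgue] by simp
qed

text \<open>Taking closures adds only frontier points, and finitely many frontiers of convex sets
  form a null set.\<close>

lemma emeasure_Inter_closure_convex:
  fixes \<G> :: "'a::euclidean_space set set"
  assumes "finite \<G>" "\<And>K. K \<in> \<G> \<Longrightarrow> convex K"
  shows "emeasure lebesgue (\<Inter>K\<in>\<G>. closure K) = emeasure lebesgue (\<Inter>\<G>)"
proof (rule antisym)
  have meas: "\<Inter>\<G> \<in> sets lebesgue"
    using assms by (intro convex_lebesgue_measurable convex_Inter) auto
  have null: "(\<Union>K\<in>\<G>. frontier K) \<in> null_sets lebesgue"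
    using assms by (auto intro!: negligible_Union negligible_convex_frontier
        simp flip: negligible_iff_null_sets)
  have "emeasure lebesgue (\<Inter>K\<in>\<G>. closure K) \<le> emeasure lebesgue (\<Inter>\<G> \<union> (\<Union>K\<in>\<G>. frontier K))"
    using meas null interior_subset by (intro emeasure_mono sets.Un) (auto simp: frontier_def)
  also have "\<dots> = emeasure lebesgue (\<Inter>\<G>)"
    by (rule emeasure_Un_null_set[OF meas null])
  finally show "emeasure lebesgue (\<Inter>K\<in>\<G>. closure K) \<le> emeasure lebesgue (\<Inter>\<G>)" .
  have "(\<Inter>K\<in>\<G>. closure K) \<in> sets lebesgue"
    using assms by (intro convex_lebesgue_measurable convex_INT convex_closure) auto
  then show "emeasure lebesgue (\<Inter>\<G>) \<le> emeasure lebesgue (\<Inter>K\<in>\<G>. closure K)"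
    using closure_subset by (intro emeasure_mono) auto
qed

text \<open>Cutting with a large ball and taking closures gives compact sets. The cut may reduce
  rainbow volumes from 1 to \<open>1 - t\<close>, which accounts for the extra factor in the
  conclusion.\<close>

lemma colourful_Helly_volume:
  fixes F :: "'i \<Rightarrow> (real ^ 'n) set set"
  assumes I: "finite I" "I \<noteq> {}" "k + m \<le> card I"
    and F: "\<And>i. i \<in> I \<Longrightarrow> finite (F i)" "\<And>i K. i \<in> I \<Longrightarrow> K \<in> F i \<Longrightarrow> convex K"
    and few: "\<And>K :: 'i \<Rightarrow> (real ^ 'n) set. (\<forall>i\<in>I. compact (K i) \<and> convex (K i)) \<Longrightarrow>
      measure lebesgue (\<Inter>i\<in>I. K i) > 0 \<Longrightarrow>
      \<exists>T\<subseteq>I. T \<noteq> {} \<and> card T \<le> k \<and>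
        measure lebesgue (\<Inter>i\<in>T. K i) \<le> C * measure lebesgue (\<Inter>i\<in>I. K i)"
    and t: "0 < t" "t < 1"
    and m: "(1 - t ^ CARD('n) / (CARD('n) + 1)) ^ m * C < 1"
    and rainbow: "\<And>K. (\<And>i. i \<in> I \<Longrightarrow> K i \<in> F i) \<Longrightarrow> vol (\<Inter>i\<in>I. K i) \<ge> 1"
  shows "\<exists>i\<in>I. vol (\<Inter>(F i)) \<ge> ennreal ((1 - t) ^ (CARD('n) + 1))"
proof (cases "\<exists>i\<in>I. F i = {}")
  \<comment> \<open>The intersection of an empty family is the whole space, of infinite
    volume.\<close>
  case True
  then obtain i where "i \<in> I" "F i = {}" by blast
  then have "vol (\<Inter>(F i)) = top" by simp
  then show ?thesis using \<open>i \<in> I\<close> by (intro bexI[of _ i]) simp_all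
next
  case False
  have "finite (PiE I F)"
    using I F by (auto intro: finite_PiE)
  moreover have "\<forall>\<^sub>F r in sequentially. vol ((\<Inter>i\<in>I. K i) \<inter> cball 0 (real r)) > ennreal (1 - t)"
    if "K \<in> PiE I F" for K
  proof (rule order_tendstoD(1)[OF emeasure_Int_cball_tendsto])
    show "(\<Inter>i\<in>I. K i) \<in> sets lebesgue"
      using F that by (intro convex_lebesgue_measurable convex_INT) auto
    have "ennreal (1 - t) < 1" using t by (simp add: ennreal_less_one_iff)
    also have "1 \<le> vol (\<Inter>i\<in>I. K i)" using rainbow that by auto
    finally show "ennreal (1 - t) < vol (\<Inter>i\<in>I. K i)" .
  qed
  \<comment> \<open>Finitely many selections on \<open>I\<close> allow one radius to serve them
    all.\<close>
  ultimately have "\<forall>\<^sub>F r in sequentially. \<forall>K\<in>PiE I F.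
      vol ((\<Inter>i\<in>I. K i) \<inter> cball 0 (real r)) > ennreal (1 - t)"
    by (intro eventually_ball_finite) auto
  then obtain r :: nat where r: "\<And>K. K \<in> PiE I F \<Longrightarrow>
      vol ((\<Inter>i\<in>I. K i) \<inter> cball 0 (real r)) > ennreal (1 - t)"
    unfolding eventually_sequentially by blast
  define G where "G i = (\<lambda>K. K \<inter> cball 0 (real r)) ` F i" for i
  have G: "finite (G i)" "\<And>K. K \<in> G i \<Longrightarrow> convex K" "\<And>K. K \<in> G i \<Longrightarrow> bounded K"
    if "i \<in> I" for i
    using F that by (auto simp: G_def intro: convex_Int)
  have "\<exists>i\<in>I. measure lebesgue (\<Inter>(closure ` G i)) \<ge> (1 - t) ^ CARD('n) * (1 - t)"
  proof (rule colourful_Helly_measure_compact[OF I _ _ _ _ few t m])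
    fix K assume K: "\<And>i. i \<in> I \<Longrightarrow> K i \<in> closure ` G i"
    then have "\<forall>i\<in>I. \<exists>X. X \<in> F i \<and> K i = closure (X \<inter> cball 0 (real r))"
      by (auto simp: G_def)
    then obtain X where X: "\<And>i. i \<in> I \<Longrightarrow> X i \<in> F i"
        "\<And>i. i \<in> I \<Longrightarrow> K i = closure (X i \<inter> cball 0 (real r))"
      by metis
    have "compact (\<Inter>i\<in>I. K i)"
      using I X by (intro compact_Inter) (auto simp: bounded_Int)
    then have lm: "(\<Inter>i\<in>I. K i) \<in> lmeasurable" by (rule lmeasurable_compact)
    have "ennreal (1 - t) < vol ((\<Inter>i\<in>I. restrict X I i) \<inter> cball 0 (real r))"
      by (rule r) (use X in auto)
    also have "\<dots> \<le> vol (\<Inter>i\<in>I. K i)"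
    proof (intro emeasure_mono fmeasurableD lm)
      show "(\<Inter>i\<in>I. restrict X I i) \<inter> cball 0 (real r) \<subseteq> (\<Inter>i\<in>I. K i)"
        using X(2) closure_subset by fastforce
    qed
    also have "\<dots> = ennreal (measure lebesgue (\<Inter>i\<in>I. K i))"
      using lm by (simp add: emeasure_eq_measure2)
    finally show "1 - t \<le> measure lebesgue (\<Inter>i\<in>I. K i)"
      using t by (simp add: ennreal_less_iff)
  next
    show "closure ` G i \<noteq> {}" if "i \<in> I" for i
      using False that by (auto simp: G_def)
  qed (use G t in auto)
  then obtain i where i: "i \<in> I" "measure lebesgue (\<Inter>(closure ` G i)) \<ge> (1 - t) ^ (CARD('n) + 1)"
    by (auto simp: mult.commute)
  have "compact (\<Inter>(closure ` G i))"
    using i(1) False G by (intro compact_Inter) (auto simp: G_def)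
  then have "ennreal (measure lebesgue (\<Inter>(closure ` G i))) = vol (\<Inter>(closure ` G i))"
    by (simp add: emeasure_eq_measure2 lmeasurable_compact)
  also have "\<dots> = vol (\<Inter>(G i))"
    using G i(1) by (intro emeasure_Inter_closure_convex) auto
  also have "\<dots> \<le> vol (\<Inter>(F i))"
    using F i(1) by (intro emeasure_mono convex_lebesgue_measurable convex_Inter) (auto simp: G_def)
  finally show ?thesis
    using i ennreal_leI order_trans by blast
qed

section \<open>Choice of the constants\<close>

theorem theorem3p6:
  fixes \<epsilon> :: real
  assumes "\<epsilon> > 0"
  shows "\<exists>n::nat. n \<ge> 1 \<and>
    (\<forall>F :: nat \<Rightarrow> (real ^ 'd) set set.
      (\<forall>i\<in>{1..n}. finite (F i) \<and> (\<forall>K\<in>F i. convex K)) \<longrightarrow>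
      (\<forall>K :: nat \<Rightarrow> (real ^ 'd) set.
        (\<forall>i\<in>{1..n}. K i \<in> F i) \<longrightarrow> vol (\<Inter>i\<in>{1..n}. K i) \<ge> 1) \<longrightarrow>
      (\<exists>i\<in>{1..n}. vol (\<Inter>(F i)) \<ge> ennreal (1 / (1 + \<epsilon>))))"
proof -
  define d where "d = CARD('d)"
  \<comment> \<open>Chosen so that \<open>1 - (d + 1) t\<close> equals
    \<open>1 / (1 + \<epsilon>)\<close>; Bernoulli's inequality then bounds
    \<open>(1 - t) ^ (d + 1)\<close> from below by it.\<close>
  define t where "t = \<epsilon> / ((1 + \<epsilon>) * (real d + 1))"
  define C where "C = (16 * real d ^ 2) ^ d"
  have "d \<ge> 1" by (simp add: d_def Suc_leI)
  have "C > 0" using \<open>d \<ge> 1\<close> by (simp add: C_def)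
  have t: "0 < t" "t < 1"
    using assms by (auto simp: t_def divide_less_eq algebra_simps add_pos_nonneg)
  have "1 / (1 + \<epsilon>) = 1 + real (d + 1) * (- t)"
  proof -
    have "real (d + 1) * t = \<epsilon> / (1 + \<epsilon>)"
      by (simp add: t_def add.commute[of 1 "real d"] nonzero_mult_divide_mult_cancel_right)
    then show ?thesis using assms by (simp add: field_simps)
  qed
  also have "\<dots> \<le> (1 + (- t)) ^ (d + 1)"
    by (rule Bernoulli_inequality) (use t in simp)
  finally have bernoulli: "1 / (1 + \<epsilon>) \<le> (1 - t) ^ (d + 1)" by simp
  obtain k where k: "\<And>(I :: nat set) K :: nat \<Rightarrow> (real ^ 'd) set. finite I \<Longrightarrow> I \<noteq> {} \<Longrightarrow>
      \<forall>i\<in>I. compact (K i) \<and> convex (K i) \<Longrightarrow> measure lebesgue (\<Inter>i\<in>I. K i) > 0 \<Longrightarrow>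
      \<exists>T\<subseteq>I. T \<noteq> {} \<and> card T \<le> k \<and>
        measure lebesgue (\<Inter>i\<in>T. K i) \<le> C * measure lebesgue (\<Inter>i\<in>I. K i)"
    using quantitative_Helly_constant unfolding C_def d_def by metis
  have "1 - t ^ d / (real d + 1) < 1" using t by simp
  then obtain m where "(1 - t ^ d / (real d + 1)) ^ m < 1 / C"
    using real_arch_pow_inv[of "1 / C" "1 - t ^ d / (real d + 1)"] \<open>C > 0\<close> by auto
  then have m: "(1 - t ^ d / (d + 1)) ^ m * C < 1"
    using \<open>C > 0\<close> by (simp add: pos_less_divide_eq add.commute)
  show ?thesis
  \<comment> \<open>The added 1 keeps the index set nonempty even if \<open>k\<close> and
    \<open>m\<close> are both 0.\<close>
  proof (intro exI[of _ "k + m + 1"] conjI allI impI)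
    fix F :: "nat \<Rightarrow> (real ^ 'd) set set"
    let ?I = "{1..k + m + 1}"
    assume F: "\<forall>i\<in>?I. finite (F i) \<and> (\<forall>K\<in>F i. convex K)"
      and rainbow: "\<forall>K. (\<forall>i\<in>?I. K i \<in> F i) \<longrightarrow> vol (\<Inter>i\<in>?I. K i) \<ge> 1"
    have "\<exists>i\<in>?I. vol (\<Inter>(F i)) \<ge> ennreal ((1 - t) ^ (CARD('d) + 1))"
    proof (rule colourful_Helly_volume[where k = k and m = m and C = C])
      show "(1 - t ^ CARD('d) / (CARD('d) + 1)) ^ m * C < 1"
        using m by (simp add: d_def)
      show "\<exists>T\<subseteq>?I. T \<noteq> {} \<and> card T \<le> k \<and>
        measure lebesgue (\<Inter>i\<in>T. K i) \<le> C * measure lebesgue (\<Inter>i\<in>?I. K i)"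
        if "\<forall>i\<in>?I. compact (K i) \<and> convex (K i)" "measure lebesgue (\<Inter>i\<in>?I. K i) > 0"
        for K :: "nat \<Rightarrow> (real ^ 'd) set"
        by (rule k) (use that in auto)
      show "vol (\<Inter>i\<in>?I. K i) \<ge> 1" if "\<And>i. i \<in> ?I \<Longrightarrow> K i \<in> F i" for K
        using rainbow that by blast
    qed (use F t in auto)
    then show "\<exists>i\<in>?I. vol (\<Inter>(F i)) \<ge> ennreal (1 / (1 + \<epsilon>))"
      using bernoulli ennreal_leI order_trans unfolding d_def by blast
  qed simp
qed

end
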